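(* Let $n\ge2$ be an integer. The $n$-ary elliptic class group $\mathrm{Cl}_n(\mathbb{Z})$ is trivial if and only if $(\mathbb{Z}/(n+1)\mathbb{Z})^{\times}=\{\pm1\}$, and this happens precisely for $n\in\{2,3,5\}$.
   Context: Let $\mathcal{F}_n:=\{r\in\mathbb{Q}_{>0}: v_p(r)=0\text{ for all primes }p\mid n+1\}$ under multiplication; equivalently, $\mathcal{F}_n=\bigoplus_{p\nmid n+1}\mathbb{Z}\,[p]$ is the free abelian group on the set of classical primes $p$ not dividing $n+1$. Let $\mathcal{P}_n:=\{m\in\mathbb{N}_{>0}: m\equiv\pm1\pmod{n+1}\}$, and let $\overline{\mathcal{P}}_n\subseteq\mathcal{F}_n$ be the subgroup generated by all $[p]$ with $p\in\mathcal{P}_n$ a classical prime, $p\nmid n+1$. The $n$-ary elliptic class group of $n\mathrm{Ell}(\mathbb{Z})$ is defined as $\mathrm{Cl}_n(\mathbb{Z}):=\mathcal{F}_n/\overline{\mathcal{P}}_n$. *)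

theory Defs
  imports "HOL-Number_Theory.Residues" "HOL-Algebra.Elementary_Groups"
begin

definition padic_val_rat :: "nat \<Rightarrow> rat \<Rightarrow> int" where
  "padic_val_rat p r =
     int (multiplicity (int p) (fst (quotient_of r))) - int (multiplicity (int p) (snd (quotient_of r)))"

definition ell_F :: "nat \<Rightarrow> rat monoid" where
  "ell_F n = \<lparr>carrier = {r. r > 0 \<and> (\<forall>p. prime p \<and> p dvd n + 1 \<longrightarrow> padic_val_rat p r = 0)},
              monoid.mult = (*), one = 1\<rparr>"

definition ell_P :: "nat \<Rightarrow> nat set" where
  "ell_P n = {m. m > 0 \<and> ([int m = 1] (mod int (n + 1)) \<or> [int m = - 1] (mod int (n + 1)))}"

text \<open>The basis element written \<open>[p]\<close> in the free abelian group is the prime \<open>p\<close> itself, as a positive rational.\<close>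

definition ell_P_subgroup :: "nat \<Rightarrow> rat set" where
  "ell_P_subgroup n = generate (ell_F n) {of_nat p | p. prime p \<and> p \<in> ell_P n \<and> \<not> p dvd n + 1}"

definition elliptic_class_group :: "nat \<Rightarrow> rat set monoid" where
  "elliptic_class_group n = ell_F n Mod ell_P_subgroup n"

end

theory Submission
  imports Defs
begin

text \<open>
  Put \<open>N = n + 1\<close>. The group \<open>\<F>\<^sub>n\<close> consists of the fractions \<open>a / b\<close> with \<open>a\<close> and \<open>b\<close>
  coprime to \<open>N\<close>. All three conditions of the theorem are compared with the statement
  that every natural number coprime to \<open>N\<close> is congruent to \<open>1\<close> or \<open>-1\<close> modulo \<open>N\<close>.

  A quotient group is trivial exactly if one divides by the whole group. If every number coprime
  to \<open>N\<close> is congruent to \<open>1\<close> or \<open>-1\<close>, then every prime not dividing \<open>N\<close> is among the generators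
  of the subgroup, and unique factorization gives all of \<open>\<F>\<^sub>n\<close>. For the converse, one might
  expect to need Dirichlet's theorem, to find a prime in a residue class other than the two
  allowed ones. It is avoided by an invariant (\<open>ell_P_subgroup_cong\<close>): \<open>a / b \<mapsto> a b\<^sup>-\<^sup>1\<close> is a
  homomorphism from \<open>\<F>\<^sub>n\<close> to the units modulo \<open>N\<close>, and it sends the generators, hence the subgroup,
  to \<open>{1, -1}\<close>. So if the subgroup is everything, then any integer \<open>a\<close> coprime to \<open>N\<close>,
  prime or not, is congruent to \<open>1\<close> or \<open>-1\<close>.

  Finally, outside \<open>N = 3, 4, 6\<close> there is an explicit third unit (\<open>exists_third_unit\<close>): \<open>2\<close> for odd
  \<open>N\<close>, and a number just below \<open>N / 2\<close> for even \<open>N\<close>.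
\<close>

section \<open>Trivial quotient groups\<close>

lemma (in normal) trivial_FactGroup_iff: "trivial_group (G Mod H) \<longleftrightarrow> H = carrier G"
proof
  assume "trivial_group (G Mod H)"
  then have only_coset: "carrier (G Mod H) = {H}"
    by (simp add: trivial_group_def)
  have "x \<in> H" if x: "x \<in> carrier G" for x
  proof -
    have "H #> x \<in> carrier (G Mod H)"
      using x by (auto simp: FactGroup_def RCOSETS_def)
    then have "H #> x = H"
      using only_coset by simp
    then show "x \<in> H"
      using coset_join1 x is_subgroup by blast
  qed
  then show "H = carrier G"
    using subset by blast
next
  assume eq: "H = carrier G"
  have "H #> x = H" if "x \<in> carrier G" for x
    using that eq coset_join2 is_subgroup by auto
  then have "carrier (G Mod H) = {H}"
    using one_closed unfolding FactGroup_def RCOSETS_def by auto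
  then show "trivial_group (G Mod H)"
    using factorgroup_is_group by (simp add: trivial_group_def)
qed

section \<open>Fractions coprime to the modulus\<close>

lemma padic_val_rat_eq_0_iff:
  assumes "prime p" and "r \<noteq> 0"
  shows "padic_val_rat p r = 0 \<longleftrightarrow>
    \<not> int p dvd fst (quotient_of r) \<and> \<not> int p dvd snd (quotient_of r)"
proof -
  obtain a b where q: "quotient_of r = (a, b)"
    by force
  have "b > 0" and "coprime a b"
    using q quotient_of_denom_pos quotient_of_coprime by blast+
  have "a \<noteq> 0"
    using q assms(2) quotient_of_div by fastforce
  have p: "prime_elem (int p)" "\<not> is_unit (int p)"
    using assms(1) by auto
  (* In lowest terms at most one of the two multiplicities is nonzero, so nothing cancels. *)
  have "\<not> int p dvd a \<or> \<not> int p dvd b"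
    using \<open>coprime a b\<close> p(2) coprime_common_divisor by blast
  moreover have "multiplicity (int p) a = 0 \<longleftrightarrow> \<not> int p dvd a"
    "multiplicity (int p) b = 0 \<longleftrightarrow> \<not> int p dvd b"
    using \<open>a \<noteq> 0\<close> \<open>b > 0\<close> p by (auto simp: multiplicity_eq_zero_iff)
  ultimately show ?thesis
    unfolding padic_val_rat_def q by auto
qed

lemma coprime_iff_no_common_prime:
  fixes a N :: nat
  shows "coprime a N \<longleftrightarrow> (\<forall>p. prime p \<and> p dvd N \<longrightarrow> \<not> p dvd a)"
proof
  assume "coprime a N"
  then show "\<forall>p. prime p \<and> p dvd N \<longrightarrow> \<not> p dvd a"
    using coprime_common_divisor not_prime_unit by blast
next
  assume no_prime: "\<forall>p. prime p \<and> p dvd N \<longrightarrow> \<not> p dvd a"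
  show "coprime a N"
  proof (rule ccontr)
    assume "\<not> coprime a N"
    then have "gcd a N \<noteq> 1"
      by (metis coprime_iff_gcd_eq_1)
    then obtain p where "prime p" "p dvd gcd a N"
      using prime_factor_nat by blast
    then have "prime p" "p dvd N" "p dvd a"
      by simp_all
    then show False
      using no_prime by blast
  qed
qed

lemma mem_carrier_ell_F_iff:
  assumes "n > 0"
  shows "r \<in> carrier (ell_F n) \<longleftrightarrow>
    (\<exists>a b. coprime a (n + 1) \<and> coprime b (n + 1) \<and> r = of_nat a / of_nat b)"
proof -
  obtain x y where q: "quotient_of r = (x, y)"
    by force
  have y: "y > 0" and xy: "coprime x y" and r: "r = of_int x / of_int y"
    using q quotient_of_denom_pos quotient_of_coprime quotient_of_div by blast+
  show ?thesis
  proof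
    assume mem: "r \<in> carrier (ell_F n)"
    then have "r > 0"
      by (simp add: ell_F_def)
    then have "x > 0"
      using r y by (simp add: zero_less_divide_iff)
    have "\<not> p dvd nat x \<and> \<not> p dvd nat y" if "prime p" "p dvd n + 1" for p
    proof -
      have "padic_val_rat p r = 0"
        using mem that by (simp add: ell_F_def)
      then have "\<not> int p dvd x \<and> \<not> int p dvd y"
        using padic_val_rat_eq_0_iff[OF that(1), of r] \<open>r > 0\<close> q by simp
      then show ?thesis
        using \<open>x > 0\<close> y by (metis int_dvd_int_iff int_nat_eq less_imp_le)
    qed
    then have "coprime (nat x) (n + 1)" "coprime (nat y) (n + 1)"
      by (auto simp: coprime_iff_no_common_prime)
    moreover have "r = of_nat (nat x) / of_nat (nat y)"
      using r \<open>x > 0\<close> y by simp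
    ultimately show "\<exists>a b. coprime a (n + 1) \<and> coprime b (n + 1) \<and> r = of_nat a / of_nat b"
      by blast
  next
    assume "\<exists>a b. coprime a (n + 1) \<and> coprime b (n + 1) \<and> r = of_nat a / of_nat b"
    then obtain a b where ab: "coprime a (n + 1)" "coprime b (n + 1)" "r = of_nat a / of_nat b"
      by blast
    have pos: "a > 0" "b > 0"
      using ab(1,2) assms by (auto intro!: Nat.gr0I)
    have "r > 0"
      using ab(3) pos by simp
    have "of_int (x * int b) = (of_int (int a * y) :: rat)"
      using r ab(3) y pos by (simp add: field_simps)
    then have cross: "x * int b = int a * y"
      by (simp only: of_int_eq_iff)
    (* The reduced numerator and denominator divide a and b. *)
    have "x dvd int a * y" "y dvd x * int b"
      using cross by (metis dvd_triv_left, metis dvd_triv_right)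
    then have "x dvd int a" "y dvd int b"
      using xy coprime_commute[of x y]
      by (simp_all add: coprime_dvd_mult_left_iff coprime_dvd_mult_right_iff)
    have "\<not> int p dvd x \<and> \<not> int p dvd y" if "prime p" "p dvd n + 1" for p
    proof -
      have "\<not> int p dvd int a" "\<not> int p dvd int b"
        using that ab(1,2) unfolding coprime_iff_no_common_prime by simp_all
      then show ?thesis
        using \<open>x dvd int a\<close> \<open>y dvd int b\<close> dvd_trans by blast
    qed
    then show "r \<in> carrier (ell_F n)"
      using \<open>r > 0\<close> padic_val_rat_eq_0_iff[of _ r] q by (auto simp: ell_F_def)
  qed
qed

lemma ell_F_simps [simp]:
  "monoid.mult (ell_F n) = (*)" "one (ell_F n) = 1"
  by (simp_all add: ell_F_def)

lemma comm_group_ell_F: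
  assumes "n > 0"
  shows "comm_group (ell_F n)"
proof (rule comm_groupI)
  fix x y
  assume "x \<in> carrier (ell_F n)" "y \<in> carrier (ell_F n)"
  then obtain a b c d where
    "coprime a (n + 1)" "coprime b (n + 1)" "x = of_nat a / of_nat b"
    "coprime c (n + 1)" "coprime d (n + 1)" "y = of_nat c / of_nat d"
    unfolding mem_carrier_ell_F_iff[OF assms] by blast
  then have "coprime (a * c) (n + 1)" "coprime (b * d) (n + 1)"
    "x * y = of_nat (a * c) / of_nat (b * d)"
    by simp_all
  then show "x \<otimes>\<^bsub>ell_F n\<^esub> y \<in> carrier (ell_F n)"
    unfolding mem_carrier_ell_F_iff[OF assms] ell_F_simps by blast
next
  have "coprime 1 (n + 1)" "(1 :: rat) = of_nat 1 / of_nat 1"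
    by simp_all
  then show "\<one>\<^bsub>ell_F n\<^esub> \<in> carrier (ell_F n)"
    unfolding mem_carrier_ell_F_iff[OF assms] ell_F_simps by blast
next
  fix x
  assume x: "x \<in> carrier (ell_F n)"
  then obtain a b where "coprime a (n + 1)" "coprime b (n + 1)" "x = of_nat a / of_nat b"
    unfolding mem_carrier_ell_F_iff[OF assms] by blast
  then have "coprime b (n + 1)" "coprime a (n + 1)" "inverse x = of_nat b / of_nat a"
    by simp_all
  then have "inverse x \<in> carrier (ell_F n)"
    unfolding mem_carrier_ell_F_iff[OF assms] by blast
  moreover have "x > 0"
    using x by (simp add: ell_F_def)
  ultimately show "\<exists>y\<in>carrier (ell_F n). y \<otimes>\<^bsub>ell_F n\<^esub> x = \<one>\<^bsub>ell_F n\<^esub>"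
    by (intro bexI[of _ "inverse x"]) auto
qed (simp_all add: mult_ac)

lemma inv_ell_F:
  assumes "n > 0" and "x \<in> carrier (ell_F n)"
  shows "inv\<^bsub>ell_F n\<^esub> x = inverse x"
proof -
  interpret comm_group "ell_F n"
    using comm_group_ell_F assms(1) .
  have "x \<noteq> 0"
    using assms(2) by (simp add: ell_F_def)
  moreover have "inv\<^bsub>ell_F n\<^esub> x * x = 1"
    using l_inv[OF assms(2)] by simp
  ultimately show ?thesis
    by (simp add: field_simps)
qed

lemma of_nat_mem_ell_F:
  assumes "n > 0" and "coprime a (n + 1)"
  shows "of_nat a \<in> carrier (ell_F n)"
  unfolding mem_carrier_ell_F_iff[OF assms(1)]
  by (rule exI[of _ a], rule exI[of _ 1]) (use assms in simp)

section \<open>The subgroup generated by the primes congruent to plus or minus one\<close>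

lemma ell_P_generators_subset:
  assumes "n > 0"
  shows "{of_nat p | p. prime p \<and> p \<in> ell_P n \<and> \<not> p dvd n + 1} \<subseteq> carrier (ell_F n)"
  using of_nat_mem_ell_F[OF assms] prime_imp_coprime by blast

lemma subgroup_ell_P_subgroup:
  assumes "n > 0"
  shows "subgroup (ell_P_subgroup n) (ell_F n)"
  unfolding ell_P_subgroup_def
  using comm_group.axioms(2)[OF comm_group_ell_F[OF assms]] ell_P_generators_subset[OF assms]
  by (rule group.generate_is_subgroup)

text \<open>
  The invariant of the subgroup: the residue of \<open>a b\<^sup>-\<^sup>1\<close> modulo \<open>n + 1\<close> is multiplicative in the
  fraction \<open>a / b\<close>, and it is \<open>1\<close> or \<open>-1\<close> on the generators. The congruences are stated between
  numerator and denominator, so that no modular inverse is needed.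
\<close>

lemma ell_P_subgroup_cong:
  assumes "n > 0" and "r \<in> ell_P_subgroup n"
  shows "\<exists>a b. coprime a (n + 1) \<and> coprime b (n + 1) \<and> r = of_nat a / of_nat b \<and>
    ([int a = int b] (mod int (n + 1)) \<or> [int a = - int b] (mod int (n + 1)))"
  using assms(2) unfolding ell_P_subgroup_def
proof (induction rule: generate.induct)
  case one
  show ?case
    by (rule exI[of _ 1], rule exI[of _ 1]) simp
next
  case (incl h)
  then obtain p where "prime p" "p \<in> ell_P n" "\<not> p dvd n + 1" "h = of_nat p"
    by blast
  then show ?case
    by (intro exI[of _ p] exI[of _ 1]) (auto simp: ell_P_def intro: prime_imp_coprime)
next
  case (inv h)
  then obtain p where p: "prime p" "p \<in> ell_P n" "\<not> p dvd n + 1" "h = of_nat p"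
    by blast
  have "h \<in> carrier (ell_F n)"
    using inv ell_P_generators_subset[OF assms(1)] by blast
  then have "inv\<^bsub>ell_F n\<^esub> h = of_nat 1 / of_nat p"
    using p(4) inv_ell_F[OF assms(1)] by (simp add: divide_inverse)
  moreover have "[int 1 = int p] (mod int (n + 1)) \<or> [int 1 = - int p] (mod int (n + 1))"
    using p(2) cong_minus_minus_iff[of "int p" "-1" "int (n + 1)"]
    by (auto simp: ell_P_def cong_sym_eq)
  moreover have "coprime 1 (n + 1)" "coprime p (n + 1)"
    using p by (auto intro: prime_imp_coprime)
  ultimately show ?case
    by blast
next
  case (eng h1 h2)
  then obtain a b c d where
    ab: "coprime a (n + 1)" "coprime b (n + 1)" "h1 = of_nat a / of_nat b"
      "[int a = int b] (mod int (n + 1)) \<or> [int a = - int b] (mod int (n + 1))" and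
    cd: "coprime c (n + 1)" "coprime d (n + 1)" "h2 = of_nat c / of_nat d"
      "[int c = int d] (mod int (n + 1)) \<or> [int c = - int d] (mod int (n + 1))"
    by blast
  have "[int (a * c) = int (b * d)] (mod int (n + 1)) \<or>
      [int (a * c) = - int (b * d)] (mod int (n + 1))"
    using ab(4) cd(4) cong_mult[of "int a" _ "int (n + 1)" "int c"] by fastforce
  moreover have "coprime (a * c) (n + 1)" "coprime (b * d) (n + 1)"
    "h1 \<otimes>\<^bsub>ell_F n\<^esub> h2 = of_nat (a * c) / of_nat (b * d)"
    using ab cd by simp_all
  ultimately show ?case
    by blast
qed

lemma of_nat_mem_ell_P_subgroup_imp:
  assumes "n > 0" and "of_nat c \<in> ell_P_subgroup n"
  shows "c \<in> ell_P n"
proof -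
  obtain a b where ab: "coprime a (n + 1)" "coprime b (n + 1)"
      "of_nat c = (of_nat a / of_nat b :: rat)"
      "[int a = int b] (mod int (n + 1)) \<or> [int a = - int b] (mod int (n + 1))"
    using ell_P_subgroup_cong[OF assms] by blast
  have pos: "a > 0" "b > 0"
    using ab(1,2) assms(1) by (auto intro!: Nat.gr0I)
  have "of_nat (c * b) = (of_nat a :: rat)"
    using ab(3) pos by (simp add: field_simps)
  then have a: "a = c * b"
    by (simp only: of_nat_eq_iff)
  have "coprime (int b) (int (n + 1))"
    using ab(2) by (simp only: coprime_int_iff)
  then have "[int c = 1] (mod int (n + 1)) \<or> [int c = - 1] (mod int (n + 1))"
    using ab(4) cong_mult_rcancel[of "int b" "int (n + 1)" "int c" 1]
      cong_mult_rcancel[of "int b" "int (n + 1)" "int c" "- 1"] unfolding a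
    by simp
  moreover have "c > 0"
    using a pos by (auto intro!: Nat.gr0I)
  ultimately show ?thesis
    by (simp add: ell_P_def)
qed

text \<open>
  The subgroup is multiplicative, so unique factorization reduces membership of \<open>a\<close> to that of
  its prime factors, each of which is a generator.
\<close>

lemma of_nat_mem_ell_P_subgroup:
  assumes "n > 0" and all: "\<And>p. coprime p (n + 1) \<Longrightarrow> p \<in> ell_P n"
    and "coprime a (n + 1)"
  shows "of_nat a \<in> ell_P_subgroup n"
  using assms(3)
proof (induction a rule: prime_divisors_induct)
  case zero
  then show ?case
    using assms(1) by simp
next
  case (unit x)
  then show ?case
    using subgroup.one_closed[OF subgroup_ell_P_subgroup[OF assms(1)]] by simp
next
  case (factor p x)
  then have p: "coprime p (n + 1)" and x: "of_nat x \<in> ell_P_subgroup n"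
    by simp_all
  have "\<not> p dvd n + 1"
    using p factor.hyps coprime_iff_no_common_prime[of p "n + 1"] by auto
  then have "of_nat p \<in> ell_P_subgroup n"
    unfolding ell_P_subgroup_def using factor.hyps all[OF p]
    by (intro generate.incl) blast
  then show ?case
    using subgroup.m_closed[OF subgroup_ell_P_subgroup[OF assms(1)] _ x] by simp
qed

lemma trivial_elliptic_class_group_iff:
  assumes "n > 0"
  shows "trivial_group (elliptic_class_group n) \<longleftrightarrow> (\<forall>a. coprime a (n + 1) \<longrightarrow> a \<in> ell_P n)"
proof -
  interpret comm_group "ell_F n"
    using comm_group_ell_F assms .
  have sub: "subgroup (ell_P_subgroup n) (ell_F n)"
    using subgroup_ell_P_subgroup assms .
  then have "trivial_group (elliptic_class_group n) \<longleftrightarrow> ell_P_subgroup n = carrier (ell_F n)"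
    unfolding elliptic_class_group_def
    by (intro normal.trivial_FactGroup_iff subgroup_imp_normal)
  also have "\<dots> \<longleftrightarrow> (\<forall>a. coprime a (n + 1) \<longrightarrow> a \<in> ell_P n)"
  proof
    assume "ell_P_subgroup n = carrier (ell_F n)"
    then show "\<forall>a. coprime a (n + 1) \<longrightarrow> a \<in> ell_P n"
      using of_nat_mem_ell_F of_nat_mem_ell_P_subgroup_imp assms by blast
  next
    assume all: "\<forall>a. coprime a (n + 1) \<longrightarrow> a \<in> ell_P n"
    have "r \<in> ell_P_subgroup n" if r: "r \<in> carrier (ell_F n)" for r
    proof -
      obtain a b where ab: "coprime a (n + 1)" "coprime b (n + 1)" "r = of_nat a / of_nat b"
        using r unfolding mem_carrier_ell_F_iff[OF assms] by blast
      have "of_nat a \<otimes>\<^bsub>ell_F n\<^esub> inv\<^bsub>ell_F n\<^esub> of_nat b \<in> ell_P_subgroup n"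
        using ab all of_nat_mem_ell_P_subgroup[OF assms]
        by (intro subgroup.m_closed[OF sub] subgroup.m_inv_closed[OF sub]) blast+
      then show ?thesis
        using ab inv_ell_F[OF assms of_nat_mem_ell_F[OF assms ab(2)]]
        by (simp add: divide_inverse)
    qed
    then show "ell_P_subgroup n = carrier (ell_F n)"
      using subgroup.subset[OF sub] by blast
  qed
  finally show ?thesis .
qed

section \<open>Units of the residue ring\<close>

lemma Units_residue_ring_eq_iff:
  fixes n :: nat
  assumes "n > 0"
  defines "R \<equiv> residue_ring (int (n + 1))"
  shows "Units R = {\<one>\<^bsub>R\<^esub>, \<ominus>\<^bsub>R\<^esub> \<one>\<^bsub>R\<^esub>} \<longleftrightarrow> (\<forall>a. coprime a (n + 1) \<longrightarrow> a \<in> ell_P n)"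
proof -
  interpret residues "int (n + 1)" R
    by unfold_locales (use assms(1) in simp, rule R_def)
  have pm: "{\<one>\<^bsub>R\<^esub>, \<ominus>\<^bsub>R\<^esub> \<one>\<^bsub>R\<^esub>} = {1, int n}"
    using assms(1) by (simp add: res_one_eq res_neg_eq zmod_minus1)
  have sub: "{1, int n} \<subseteq> Units R"
    using assms(1) coprime_add_one_right[of "int n"] unfolding res_units_eq
    by (auto simp: add.commute)
  have ell_P_iff: "a \<in> ell_P n \<longleftrightarrow> int a mod int (n + 1) \<in> {1, int n}" if "coprime a (n + 1)" for a
  proof -
    have "a > 0"
      using that assms(1) by (auto intro!: Nat.gr0I)
    moreover have "1 mod int (n + 1) = 1" "(- 1) mod int (n + 1) = int n"
      using assms(1) by (simp_all add: zmod_minus1)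
    ultimately show ?thesis
      by (auto simp: ell_P_def cong_def)
  qed
  show ?thesis
    unfolding pm
  proof
    assume units: "Units R = {1, int n}"
    show "\<forall>a. coprime a (n + 1) \<longrightarrow> a \<in> ell_P n"
    proof (intro allI impI)
      fix a assume a: "coprime a (n + 1)"
      then have "coprime (int a) (int (n + 1))"
        by (simp only: coprime_int_iff)
      then have "int a mod int (n + 1) \<in> Units R"
        by (rule mod_in_res_units[OF m_gt_one])
      then show "a \<in> ell_P n"
        using units ell_P_iff[OF a] by simp
    qed
  next
    assume all: "\<forall>a. coprime a (n + 1) \<longrightarrow> a \<in> ell_P n"
    have "x \<in> {1, int n}" if "x \<in> Units R" for x
    proof -
      have x: "0 < x" "x < int (n + 1)" "coprime x (int (n + 1))"
        using that unfolding res_units_eq by auto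
      then have "coprime (nat x) (n + 1)"
        by (metis coprime_int_iff int_nat_eq less_imp_le)
      then have "int (nat x) mod int (n + 1) \<in> {1, int n}"
        using all ell_P_iff by blast
      then show ?thesis
        using x by simp
    qed
    then show "Units R = {1, int n}"
      using sub by blast
  qed
qed

text \<open>
  For odd \<open>N\<close> the number \<open>2\<close> is a unit. For \<open>N = 2 k\<close> a unit is an odd number coprime to \<open>k\<close>:
  this holds for \<open>k - 1\<close> if \<open>k\<close> is even and for \<open>k - 2\<close> if \<open>k\<close> is odd. The excluded moduli are those
  where these numbers are \<open>1\<close> or \<open>N - 1\<close>.
\<close>

lemma exists_third_unit:
  fixes N :: nat
  assumes "N \<ge> 3" and "N \<notin> {3, 4, 6}"
  shows "\<exists>a. coprime a N \<and> 1 < a \<and> a < N - 1"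
proof (cases "even N")
  case False
  then have "coprime 2 N"
    by simp
  moreover have "2 < N - 1"
    using assms False by auto
  ultimately show ?thesis
    by (intro exI[of _ 2]) simp
next
  case True
  then obtain k where k: "N = 2 * k"
    by (rule evenE)
  show ?thesis
  proof (cases "even k")
    case True
    moreover have "k \<ge> 2" "k \<noteq> 2"
      using assms k by auto
    ultimately have "k \<ge> 4"
      by presburger
    then have "coprime (k - 1) 2" "coprime (k - 1) k"
      using True coprime_diff_one_left_nat[of k] by auto
    then have "coprime (k - 1) N"
      by (simp add: k)
    then show ?thesis
      using \<open>k \<ge> 4\<close> k by (intro exI[of _ "k - 1"]) auto
  next
    case False
    moreover have "k \<ge> 2" "k \<noteq> 3"
      using assms k by auto
    ultimately have "k \<ge> 5"
      by presburger
    obtain j where j: "k = j + 2"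
      using \<open>k \<ge> 5\<close> by (intro that[of "k - 2"]) simp
    then have "odd j"
      using False by simp
    then have coprime_2: "coprime j 2"
      by simp
    then have "coprime j k"
      unfolding j coprime_iff_gcd_eq_1 by (simp only: gcd_add2)
    with coprime_2 have "coprime j N"
      by (simp add: k)
    then show ?thesis
      using \<open>k \<ge> 5\<close> j k by (intro exI[of _ j]) auto
  qed
qed

lemma all_coprime_mem_ell_P_iff:
  assumes "n \<ge> 2"
  shows "(\<forall>a. coprime a (n + 1) \<longrightarrow> a \<in> ell_P n) \<longleftrightarrow> n \<in> {2, 3, 5}"
proof
  assume all: "\<forall>a. coprime a (n + 1) \<longrightarrow> a \<in> ell_P n"
  show "n \<in> {2, 3, 5}"
  proof (rule ccontr)
    assume "n \<notin> {2, 3, 5}"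
    then obtain a where a: "coprime a (n + 1)" "1 < a" "a < n"
      using exists_third_unit[of "n + 1"] assms by auto
    then have "int a mod int (n + 1) = 1 \<or> int a mod int (n + 1) = int n"
      using all by (auto simp: ell_P_def cong_def zmod_minus1)
    then show False
      using a by simp
  qed
next
  assume n: "n \<in> {2, 3, 5}"
  show "\<forall>a. coprime a (n + 1) \<longrightarrow> a \<in> ell_P n"
  proof (intro allI impI)
    fix a assume a: "coprime a (n + 1)"
    then have "a > 0"
      using assms by (auto intro!: Nat.gr0I)
    have odd: "odd a" if "even (n + 1)"
      using a that coprime_common_divisor odd_one by blast
    have not3: "\<not> 3 dvd a" if "3 dvd n + 1"
      using a that coprime_common_divisor[of a "n + 1" 3] by auto
    have "[int a = 1] (mod int (n + 1)) \<or> [int a = - 1] (mod int (n + 1))"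
      using n odd not3 unfolding cong_def by (elim insertE emptyE; simp; presburger)
    then show "a \<in> ell_P n"
      using \<open>a > 0\<close> by (simp add: ell_P_def)
  qed
qed

section \<open>Triviality of the class group\<close>

theorem corollary8p3:
  fixes n :: nat
  assumes "n \<ge> 2"
  defines "R \<equiv> residue_ring (int (n + 1))"
  shows "(trivial_group (elliptic_class_group n) \<longleftrightarrow> Units R = {\<one>\<^bsub>R\<^esub>, \<ominus>\<^bsub>R\<^esub> \<one>\<^bsub>R\<^esub>})
       \<and> (Units R = {\<one>\<^bsub>R\<^esub>, \<ominus>\<^bsub>R\<^esub> \<one>\<^bsub>R\<^esub>} \<longleftrightarrow> n \<in> {2, 3, 5})"
proof -
  have "n > 0"
    using assms(1) by simp
  show ?thesis
    unfolding R_def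
    using trivial_elliptic_class_group_iff[OF \<open>n > 0\<close>] Units_residue_ring_eq_iff[OF \<open>n > 0\<close>]
      all_coprime_mem_ell_P_iff[OF assms(1)]
    by blast
qed

end
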